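(* Let $\Sigma$ be the Markov jump linear system $x(k+1)=A_{r(k)}x(k)+B_{r(k)}u(k)$, let $\mathcal T_{s,\Lambda}$ be the family of observation processes induced by the Markov chain $s$ and the set $\Lambda$, let $T$ be a positive integer, let $\bar{\mathfrak X}=[N]\times[M]\times[N]\times[T]$, and let $\bar p_{\chi,\chi'}$ ($\chi,\chi'\in\bar{\mathfrak X}$) be the transition probabilities defined in the context. For a family $R=\{R_\chi\}_{\chi\in\bar{\mathfrak X}}\subset\mathbb{R}^{n\times n}$ define $$\mathcal D_\chi(R)=\sum_{\chi'\in\bar{\mathfrak X}}\bar p_{\chi',\chi}R_{\chi'}.$$ Assume that matrices $R_\chi\in\mathbb{R}^{n\times n}$ ($\chi\in\bar{\mathfrak X}$), $G_{\gamma,\delta}\in\mathbb{R}^{n\times n}$ and $F_{\gamma,\delta}\in\mathbb{R}^{m\times n}$ ($\gamma\in[N]$, $\delta\in[T]$) satisfy the linear matrix inequality $$\begin{bmatrix} R_\chi & A_\alpha G_{\gamma,\delta}+B_\alpha F_{\gamma,\delta}\\ G_{\gamma,\delta}^\top A_\alpha^\top+F_{\gamma,\delta}^\top B_\alpha^\top & G_{\gamma,\delta}+G_{\gamma,\delta}^\top-\mathcal D_\chi(R)\end{bmatrix}>0$$ for all $\chi=(\alpha,\beta,\gamma,\delta)\in\bar{\mathfrak X}$. For each $\gamma\in[N]$ and $\delta\in[T]$ define $K_{\gamma,\delta}=F_{\gamma,\delta}G_{\gamma,\delta}^{-1}$. Then $K=\{K_{\gamma,\delta}\}_{\gamma\in[N],\delta\in[T]}$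 stabilizes $(\Sigma,\mathcal T_{s,\Lambda})$.
   Context: Notation: $[N]=\{1,\dots,N\}$; $\mathbb N$ is the set of nonnegative integers; $n,m,N,M,T$ are positive integers. For an integer $k$, $\lfloor k\rfloor_T$ is the unique integer in $[T]$ such that $k-\lfloor k\rfloor_T$ is an integer multiple of $T$. $\mathbf 1(\cdot)$ equals $1$ if the condition holds and $0$ otherwise. $\|\cdot\|$ is the Euclidean norm. For a real matrix $X$, $X>0$ means that $X$ is symmetric and positive definite. System: $A_1,\dots,A_N\in\mathbb{R}^{n\times n}$, $B_1,\dots,B_N\in\mathbb{R}^{n\times m}$; $r=\{r(k)\}_{k\ge0}$ is a time-homogeneous Markov chain on $[N]$ with transition probability matrix $P=[p_{ij}]$; the initial values $x(0)=x_0\in\mathbb{R}^n$ and $r(0)=r_0\in[N]$ are constants. Observations: $s$ is a time-homogeneous Markov chain on $[M]$ with transition probability matrix $Q=[q_{ij}]$, independent of $r$, and $\Lambda\subset[M]$ is a nonempty set recurrent for $s$, in the sense that from every initial state, with probability one $s(k)\in\Lambda$ for infinitely many $k$. For an initial state $s_0\in[M]$, $s(\cdot;s_0)$ is the chain $s$ started at $s_0$ and $t_\Lambda(s(\cdot;s_0))=\{t_i\}_{i\ge0}$ is the increasing enumeration of $\{k\in\mathbb N: s(k;s_0)\in\Lambda\}$. Put $\mathcal T_{s,\Lambda}=\{t_\Lambda(s(\cdot;s_0))\}_{s_0=1}^M$. For $t=\{t_i\}\in\mathcal T_{s,\Lambda}$, an integer $\tau_0<0$ and $\sigma_0\in[N]$,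 set $\tau(k)=\max\{t_i:t_i\le k\}$ and $\sigma(k)=r(\tau(k))$ if $k\ge\max(0,t_0)$, and $\tau(k)=\tau_0$, $\sigma(k)=\sigma_0$ otherwise. Transition probabilities: for $\chi=(\alpha,\beta,\gamma,\delta)$ and $\chi'=(\alpha',\beta',\gamma',\delta')$ in $\bar{\mathfrak X}=[N]\times[M]\times[N]\times[T]$, $$\bar p_{\chi,\chi'}=\begin{cases}\mathbf 1(\alpha'=\gamma',\ \delta'=1)\,p_{\alpha,\alpha'}q_{\beta,\beta'} & \text{if }\beta'\in\Lambda,\\ \mathbf 1(\gamma'=\gamma,\ \delta'=\lfloor\delta+1\rfloor_T)\,p_{\alpha,\alpha'}q_{\beta,\beta'} & \text{if }\beta'\notin\Lambda.\end{cases}$$ Stabilization of $(\Sigma,\mathcal T)$: given gains $K_{\gamma,\delta}\in\mathbb{R}^{m\times n}$, $\gamma\in[N]$, $\delta\in[T]$, the feedback $u(k)=K_{\sigma(k),\lfloor k+1-\tau(k)\rfloor_T}x(k)$ gives the closed loop $\Sigma_K$: $x(k+1)=(A_{r(k)}+B_{r(k)}K_{\sigma(k),\lfloor k+1-\tau(k)\rfloor_T})x(k)$. For a set $\mathcal T$ of observation processes, $K$ stabilizes $(\Sigma,\mathcal T)$ if there exist $C>0$ and $\epsilon\in[0,1)$ such that the solution of $\Sigma_K$ satisfies $E[\|x(k)\|^2]\le C\epsilon^k\|x_0\|^2$ for all $k\ge0$, $x_0\in\mathbb{R}^n$, $r_0\in[N]$, integers $\tau_0<0$, $\sigma_0\in[N]$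 and $t\in\mathcal T$. *)

theory Defs
  imports "HOL-Probability.Probability"
begin

definition positive_definite :: "real^'a^'a \<Rightarrow> bool" where
  "positive_definite X \<longleftrightarrow> transpose X = X \<and> (\<forall>v. v \<noteq> 0 \<longrightarrow> v \<bullet> (X *v v) > 0)"

definition block_matrix ::
    "real^'a^'a \<Rightarrow> real^'b^'a \<Rightarrow> real^'a^'b \<Rightarrow> real^'b^'b \<Rightarrow> real^('a + 'b)^('a + 'b)" where
  "block_matrix X Y Z W =
     (\<chi> i j. case i of
         Inl i1 \<Rightarrow> (case j of Inl j1 \<Rightarrow> X $ i1 $ j1 | Inr j2 \<Rightarrow> Y $ i1 $ j2)
       | Inr i2 \<Rightarrow> (case j of Inl j1 \<Rightarrow> Z $ i2 $ j1 | Inr j2 \<Rightarrow> W $ i2 $ j2))"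

definition transition_matrix :: "nat \<Rightarrow> (nat \<Rightarrow> nat \<Rightarrow> real) \<Rightarrow> bool" where
  "transition_matrix N p \<longleftrightarrow>
     (\<forall>i\<in>{1..N}. (\<forall>j\<in>{1..N}. 0 \<le> p i j) \<and> (\<Sum>j\<in>{1..N}. p i j) = 1)"

text \<open>
  A time-homogeneous Markov chain on the states \<open>1, \<dots>, N\<close> with deterministic initial state.
  The transition law is required only given histories of positive probability, because
  conditioning on a null event yields \<open>0\<close> in HOL.
\<close>

definition markov_chain ::
    "'w measure \<Rightarrow> nat \<Rightarrow> (nat \<Rightarrow> nat \<Rightarrow> real) \<Rightarrow> nat \<Rightarrow> (nat \<Rightarrow> 'w \<Rightarrow> nat) \<Rightarrow> bool" where
  "markov_chain \<Omega> N p i0 X \<longleftrightarrow>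
     (\<forall>k. X k \<in> measurable \<Omega> (count_space {1..N})) \<and>
     (\<forall>\<omega>\<in>space \<Omega>. X 0 \<omega> = i0) \<and>
     (\<forall>k h. \<forall>j\<in>{1..N}.
        \<P>(\<omega> in \<Omega>. \<forall>l\<le>k. X l \<omega> = h l) > 0 \<longrightarrow>
        \<P>(\<omega> in \<Omega>. X (Suc k) \<omega> = j \<bar> \<forall>l\<le>k. X l \<omega> = h l) = p (h k) j)"

definition independent_processes ::
    "'w measure \<Rightarrow> nat \<Rightarrow> (nat \<Rightarrow> 'w \<Rightarrow> nat) \<Rightarrow> nat \<Rightarrow> (nat \<Rightarrow> 'w \<Rightarrow> nat) \<Rightarrow> bool" where
  "independent_processes \<Omega> N X M Y \<longleftrightarrow>
     prob_space.indep_var \<Omega>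
       (Pi\<^sub>M UNIV (\<lambda>_. count_space {1..N})) (\<lambda>\<omega> k. X k \<omega>)
       (Pi\<^sub>M UNIV (\<lambda>_. count_space {1..M})) (\<lambda>\<omega> k. Y k \<omega>)"

definition wrap :: "nat \<Rightarrow> int \<Rightarrow> nat" where
  "wrap T k = (THE j. j \<in> {1..T} \<and> int T dvd (k - int j))"

lemma wrap_eq:
  assumes "T > 0"
  shows "wrap T k = Suc (nat ((k - 1) mod int T))"
  unfolding wrap_def
proof (rule the_equality)
  have b: "0 \<le> (k - 1) mod int T" "(k - 1) mod int T < int T"
    using assms by simp_all
  have e: "k - int (Suc (nat ((k - 1) mod int T))) = (k - 1) - (k - 1) mod int T"
    using b by simp
  have "int T dvd (k - int (Suc (nat ((k - 1) mod int T))))"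
    unfolding e by (rule dvd_minus_mod)
  moreover have "Suc (nat ((k - 1) mod int T)) \<in> {1..T}"
    using b by (simp add: Suc_le_eq nat_less_iff)
  ultimately show "Suc (nat ((k - 1) mod int T)) \<in> {1..T} \<and>
      int T dvd (k - int (Suc (nat ((k - 1) mod int T))))"
    by blast
next
  fix j assume j: "j \<in> {1..T} \<and> int T dvd (k - int j)"
  then have "int T dvd (k - 1) - (int j - 1)" by simp
  then have "(k - 1) mod int T = (int j - 1) mod int T"
    by (simp add: mod_eq_dvd_iff)
  also have "\<dots> = int j - 1" using j by (intro mod_pos_pos_trivial) auto
  finally show "j = Suc (nat ((k - 1) mod int T))" using j by (simp add: nat_diff_distrib')
qed

text \<open>
  \<^const>\<open>enumerate\<close> is the increasing enumeration of an infinite set of naturals.  A path that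
  visits \<open>\<Lambda>\<close> only finitely often gets arbitrary values from some index on.
\<close>

definition hitting_times :: "nat set \<Rightarrow> (nat \<Rightarrow> 'w \<Rightarrow> nat) \<Rightarrow> 'w \<Rightarrow> nat \<Rightarrow> nat" where
  "hitting_times \<Lambda> X \<omega> = enumerate {k. X k \<omega> \<in> \<Lambda>}"

definition observation_family ::
    "nat \<Rightarrow> (nat \<Rightarrow> nat \<Rightarrow> 'w \<Rightarrow> nat) \<Rightarrow> nat set \<Rightarrow> ('w \<Rightarrow> nat \<Rightarrow> nat) set" where
  "observation_family M s \<Lambda> = {hitting_times \<Lambda> (s s0) | s0. s0 \<in> {1..M}}"

definition last_obs_time :: "(nat \<Rightarrow> nat) \<Rightarrow> int \<Rightarrow> nat \<Rightarrow> int" where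
  "last_obs_time t \<tau>0 k = (if t 0 \<le> k then int (Max {t i | i. t i \<le> k}) else \<tau>0)"

definition last_obs_mode :: "(nat \<Rightarrow> nat) \<Rightarrow> (nat \<Rightarrow> nat) \<Rightarrow> nat \<Rightarrow> nat \<Rightarrow> nat" where
  "last_obs_mode t \<rho> \<sigma>0 k = (if t 0 \<le> k then \<rho> (Max {t i | i. t i \<le> k}) else \<sigma>0)"

text \<open>
  Along a fixed mode path \<open>\<rho>\<close> and fixed observation times \<open>t\<close>.
\<close>

primrec closed_loop ::
    "(nat \<Rightarrow> real^'n^'n) \<Rightarrow> (nat \<Rightarrow> real^'m^'n) \<Rightarrow> nat \<Rightarrow> (nat \<Rightarrow> nat \<Rightarrow> real^'n^'m) \<Rightarrow>
     (nat \<Rightarrow> nat) \<Rightarrow> (nat \<Rightarrow> nat) \<Rightarrow> int \<Rightarrow> nat \<Rightarrow> real^'n \<Rightarrow> nat \<Rightarrow> real^'n" where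
  "closed_loop A B T K \<rho> t \<tau>0 \<sigma>0 x0 0 = x0"
| "closed_loop A B T K \<rho> t \<tau>0 \<sigma>0 x0 (Suc k) =
     (A (\<rho> k) + B (\<rho> k) **
        K (last_obs_mode t \<rho> \<sigma>0 k) (wrap T (int k + 1 - last_obs_time t \<tau>0 k)))
     *v closed_loop A B T K \<rho> t \<tau>0 \<sigma>0 x0 k"

text \<open>
  Here \<open>r r0\<close> is the mode process started at \<open>r0\<close>.  Integrability is demanded explicitly
  because the Bochner integral of a non-integrable function is \<open>0\<close>.
\<close>

definition stabilizes ::
    "'w measure \<Rightarrow> nat \<Rightarrow> (nat \<Rightarrow> real^'n^'n) \<Rightarrow> (nat \<Rightarrow> real^'m^'n) \<Rightarrow>
     (nat \<Rightarrow> nat \<Rightarrow> 'w \<Rightarrow> nat) \<Rightarrow> ('w \<Rightarrow> nat \<Rightarrow> nat) set \<Rightarrow> nat \<Rightarrow>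
     (nat \<Rightarrow> nat \<Rightarrow> real^'n^'m) \<Rightarrow> bool" where
  "stabilizes \<Omega> N A B r \<T> T K \<longleftrightarrow>
     (\<exists>C>0. \<exists>\<epsilon>\<in>{0..<1}. \<forall>k x0. \<forall>r0\<in>{1..N}. \<forall>\<tau>0<0. \<forall>\<sigma>0\<in>{1..N}. \<forall>t\<in>\<T>.
        let x = (\<lambda>\<omega>. closed_loop A B T K (\<lambda>l. r r0 l \<omega>) (t \<omega>) \<tau>0 \<sigma>0 x0 k)
        in integrable \<Omega> (\<lambda>\<omega>. (norm (x \<omega>))\<^sup>2) \<and>
           (\<integral>\<omega>. (norm (x \<omega>))\<^sup>2 \<partial>\<Omega>) \<le> C * \<epsilon> ^ k * (norm x0)\<^sup>2)"

type_synonym ext_mode = "nat \<times> nat \<times> nat \<times> nat"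

definition ext_modes :: "nat \<Rightarrow> nat \<Rightarrow> nat \<Rightarrow> ext_mode set" where
  "ext_modes N M T = {1..N} \<times> {1..M} \<times> {1..N} \<times> {1..T}"

definition ext_trans ::
    "(nat \<Rightarrow> nat \<Rightarrow> real) \<Rightarrow> (nat \<Rightarrow> nat \<Rightarrow> real) \<Rightarrow> nat set \<Rightarrow> nat \<Rightarrow> ext_mode \<Rightarrow> ext_mode \<Rightarrow> real" where
  "ext_trans p q \<Lambda> T =
     (\<lambda>(\<alpha>, \<beta>, \<gamma>, \<delta>) (\<alpha>', \<beta>', \<gamma>', \<delta>').
        if \<beta>' \<in> \<Lambda> then of_bool (\<alpha>' = \<gamma>' \<and> \<delta>' = 1) * p \<alpha> \<alpha>' * q \<beta> \<beta>'
        else of_bool (\<gamma>' = \<gamma> \<and> \<delta>' = wrap T (int \<delta> + 1)) * p \<alpha> \<alpha>' * q \<beta> \<beta>')"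

definition ext_D ::
    "nat \<Rightarrow> nat \<Rightarrow> nat \<Rightarrow> (nat \<Rightarrow> nat \<Rightarrow> real) \<Rightarrow> (nat \<Rightarrow> nat \<Rightarrow> real) \<Rightarrow> nat set \<Rightarrow>
     (ext_mode \<Rightarrow> real^'n^'n) \<Rightarrow> ext_mode \<Rightarrow> real^'n^'n" where
  "ext_D N M T p q \<Lambda> R c = (\<Sum>c'\<in>ext_modes N M T. ext_trans p q \<Lambda> T c' c *\<^sub>R R c')"

end

theory Submission
  imports Defs
begin

text \<open>
  Write \<open>c = (\<alpha>, \<beta>, \<gamma>, \<delta>)\<close> for an extended mode and \<open>H c = A \<alpha> + B \<alpha> ** K \<gamma> \<delta>\<close> for the
  closed-loop matrix it selects.  Testing the block matrix of the linear matrix inequality on the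
  vector \<open>(u, - v)\<close> with \<open>v = transpose (H c) *v u\<close> makes the terms containing \<open>G\<close> cancel and leaves
  the strict inequality \<open>v \<bullet> (\<D> c *v v) < u \<bullet> (R c *v u)\<close> for \<open>u \<noteq> 0\<close>, where \<open>\<D> c\<close> is the
  transition-weighted sum of the \<open>R c'\<close> over the predecessors \<open>c'\<close> of \<open>c\<close> (\<open>lmi_imp_lyapunov\<close>).
  By compactness of the unit sphere and finiteness of the set of modes it improves to a
  factor \<open>e < 1\<close> on the right that is the same for all modes (\<open>strict_form_contraction\<close>,
  \<open>finite_uniform_bounds\<close>).

  This is a Lyapunov inequality for the forward evolution of second moments.  Put
  \<open>Z k c v = E [(v \<bullet> x k)^2; c k = c]\<close>, where \<open>x\<close> is the state and \<open>c k\<close> the extended mode at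
  time \<open>k\<close>.  The Markov property gives
  \<open>Z (k + 1) c v = (\<Sum>c'. P c' c * Z k c' (transpose (H c') *v v))\<close> (\<open>second_moment_Suc\<close>), so
  \<open>Z k c (transpose (H c) *v u) \<le> \<kappa> * e ^ k * (norm x0)^2 * (u \<bullet> (R c *v u))\<close> follows by induction on
  \<open>k\<close> (\<open>second_moment_decay\<close>).  Summing over \<open>c\<close> and over the basis vectors \<open>u\<close> bounds
  \<open>E [(norm (x (k + 1)))^2]\<close> geometrically (\<open>mean_square_decay\<close>).  Evolving the moments forward
  uses the matrices \<open>R\<close> directly, so that neither spectral radii nor a dual system occur.

  Two facts connect this with the statement.  Along a path that visits \<open>\<Lambda>\<close> infinitely often, the
  last observed mode and the wrapped age of the last observation obey the one-step recursion behind
  \<^const>\<open>ext_trans\<close> (\<open>ext_path_eq_observation\<close>); and the process defined by that recursion is a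
  Markov chain with these transition probabilities, because an extended history is equivalent to a
  pair of histories of the independent chains \<open>r\<close> and \<open>s\<close> (\<open>ext_path_chain\<close>).  The remaining paths
  form a null set, but integrability of the closed loop needs its measurability there too, which is
  what \<open>closed_loop_measurable\<close> supplies.
\<close>

section \<open>Quadratic forms and the linear matrix inequality\<close>

lemma block_quadratic_form:
  fixes X :: "real^'a^'a" and W :: "real^'b^'b"
  shows "(\<chi> i. case i of Inl a \<Rightarrow> u $ a | Inr b \<Rightarrow> w $ b) \<bullet>
           (block_matrix X Y Z W *v (\<chi> i. case i of Inl a \<Rightarrow> u $ a | Inr b \<Rightarrow> w $ b)) =
         u \<bullet> (X *v u) + u \<bullet> (Y *v w) + w \<bullet> (Z *v u) + w \<bullet> (W *v w)"
  by (simp add: inner_vec_def matrix_vector_mult_def block_matrix_def UNIV_Plus_UNIV[symmetric]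
      sum.Plus sum.distrib distrib_left del: UNIV_Plus_UNIV)

lemma positive_definite_block:
  fixes X :: "real^'a^'a" and W :: "real^'b^'b"
  assumes "positive_definite (block_matrix X Y Z W)" and "u \<noteq> 0 \<or> w \<noteq> 0"
  shows "u \<bullet> (X *v u) + u \<bullet> (Y *v w) + w \<bullet> (Z *v u) + w \<bullet> (W *v w) > 0"
proof -
  let ?v = "(\<chi> i. case i of Inl a \<Rightarrow> u $ a | Inr b \<Rightarrow> w $ b) :: real^('a + 'b)"
  have "?v \<noteq> 0"
  proof
    assume v: "?v = 0"
    have "u $ a = 0" for a using arg_cong[OF v, of "\<lambda>z. z $ Inl a"] by simp
    moreover have "w $ b = 0" for b using arg_cong[OF v, of "\<lambda>z. z $ Inr b"] by simp
    ultimately show False using assms(2) by (simp add: vec_eq_iff)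
  qed
  then show ?thesis
    using assms(1) unfolding positive_definite_def block_quadratic_form[symmetric] by blast
qed

text \<open>
  Nonnegativity of \<open>D\<close> makes \<open>G + transpose G\<close> positive definite, hence \<open>G\<close> injective and therefore
  invertible, and then \<open>A ** G + B ** F = H ** G\<close>.  For \<open>v = transpose H *v u\<close> the two off-diagonal
  terms of the form at \<open>(u, - v)\<close> add up to \<open>- 2 * (v \<bullet> (G *v v))\<close>, which is the negative of the
  contribution of \<open>G + transpose G\<close>.  No inverse of \<open>D\<close> is taken: it may be singular.
\<close>

lemma lmi_imp_lyapunov:
  fixes A G R D :: "real^'n^'n" and B :: "real^'m^'n" and F :: "real^'n^'m"
  assumes lmi: "positive_definite
      (block_matrix R (A ** G + B ** F)
         (transpose G ** transpose A + transpose F ** transpose B) (G + transpose G - D))"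
    and D: "\<And>v. 0 \<le> v \<bullet> (D *v v)"
    and H: "H = A + B ** (F ** matrix_inv G)"
    and u: "u \<noteq> 0"
  shows "(transpose H *v u) \<bullet> (D *v (transpose H *v u)) < u \<bullet> (R *v u)"
proof -
  have GT: "w \<bullet> (transpose G *v w) = w \<bullet> (G *v w)" for w
    by (metis dot_lmul_matrix inner_commute transpose_matrix_vector)
  have "inj ((*v) G)"
  proof (rule injI)
    fix a b assume "G *v a = G *v b"
    then have z: "G *v (a - b) = 0" by (simp add: matrix_vector_mult_diff_distrib)
    show "a = b"
    proof (rule ccontr)
      assume "a \<noteq> b"
      then have "0 < (a - b) \<bullet> ((G + transpose G - D) *v (a - b))"
        using positive_definite_block[OF lmi, of 0 "a - b"] by simp
      then show False
        using D[of "a - b"] GT[of "a - b"] z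
        by (simp add: matrix_vector_mult_diff_rdistrib matrix_vector_mult_add_rdistrib
            inner_diff_right inner_add_right)
    qed
  qed
  then have "invertible G"
    by (simp add: invertible_left_inverse matrix_left_invertible_injective)
  then have "matrix_inv G ** G = mat 1"
    unfolding invertible_def matrix_inv_def by (rule someI2_ex) blast
  then have "(B ** (F ** matrix_inv G)) ** G = B ** F"
    by (simp add: matrix_mul_assoc[symmetric])
  moreover have "(A + C) ** G = A ** G + C ** G" for C
    by (simp add: matrix_matrix_mult_def vec_eq_iff sum.distrib distrib_right)
  ultimately have HG: "A ** G + B ** F = H ** G"
    by (simp add: H)
  have HG': "transpose G ** transpose A + transpose F ** transpose B = transpose (H ** G)"
    unfolding HG[symmetric] matrix_transpose_mul[symmetric] by (simp add: transpose_def vec_eq_iff)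
  define v where "v = transpose H *v u"
  have 1: "u \<bullet> ((H ** G) *v v) = v \<bullet> (G *v v)"
    by (metis dot_lmul_matrix matrix_vector_mul_assoc transpose_matrix_vector v_def)
  have 2: "v \<bullet> (transpose (H ** G) *v u) = v \<bullet> (G *v v)"
    by (metis 1 dot_lmul_matrix inner_commute transpose_matrix_vector)
  have neg: "X *v (- w) = - (X *v w)" for X :: "real^'n^'n" and w
    by (simp add: linear_neg)
  have "0 < u \<bullet> (R *v u) + u \<bullet> ((H ** G) *v (- v)) + (- v) \<bullet> (transpose (H ** G) *v u) +
      (- v) \<bullet> ((G + transpose G - D) *v (- v))"
    using u by (intro positive_definite_block[OF lmi[unfolded HG HG']]) simp
  then show ?thesis
    unfolding v_def[symmetric] neg matrix_vector_mult_diff_rdistrib matrix_vector_mult_add_rdistrib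
      inner_diff_right inner_add_right inner_minus_left inner_minus_right 1 2 GT
    by simp
qed

lemma coercive_quadratic_form:
  fixes X :: "real^'n^'n"
  assumes "\<And>u. u \<noteq> 0 \<Longrightarrow> 0 < u \<bullet> (X *v u)"
  shows "\<exists>m>0. \<forall>u. m * (norm u)\<^sup>2 \<le> u \<bullet> (X *v u)"
proof -
  have "continuous_on (sphere 0 1) (\<lambda>u. u \<bullet> (X *v u))"
    by (intro continuous_intros matrix_vector_mult_linear_continuous_on)
  moreover have "sphere (0::real^'n) 1 \<noteq> {}"
    by simp
  ultimately obtain e where e: "e \<in> sphere 0 1"
    and min: "\<And>u. u \<in> sphere 0 1 \<Longrightarrow> e \<bullet> (X *v e) \<le> u \<bullet> (X *v u)"
    using continuous_attains_inf[OF compact_sphere] by blast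
  have "(e \<bullet> (X *v e)) * (norm u)\<^sup>2 \<le> u \<bullet> (X *v u)" for u
  proof (cases "u = 0")
    case False
    let ?w = "u /\<^sub>R norm u"
    have u: "u = norm u *\<^sub>R ?w" using False by simp
    have "u \<bullet> (X *v u) = (norm u)\<^sup>2 * (?w \<bullet> (X *v ?w))"
      by (subst (1 2) u) (simp add: matrix_vector_mult_scaleR power2_eq_square)
    moreover have "e \<bullet> (X *v e) \<le> ?w \<bullet> (X *v ?w)"
      using False by (intro min) simp
    ultimately show ?thesis by (metis mult.commute mult_left_mono zero_le_power2)
  qed simp
  moreover have "0 < e \<bullet> (X *v e)" using e by (intro assms) auto
  ultimately show ?thesis by blast
qed

lemma bounded_quadratic_form:
  fixes X :: "real^'n^'n"
  shows "\<exists>b>0. \<forall>u. u \<bullet> (X *v u) \<le> b * (norm u)\<^sup>2"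
proof -
  obtain b where b: "b > 0" "\<And>u. norm (X *v u) \<le> norm u * b"
    using bounded_linear.pos_bounded[OF matrix_vector_mul_bounded_linear] by blast
  have "u \<bullet> (X *v u) \<le> b * (norm u)\<^sup>2" for u
  proof -
    have "u \<bullet> (X *v u) \<le> norm u * norm (X *v u)" by (rule norm_cauchy_schwarz)
    also have "\<dots> \<le> norm u * (norm u * b)" by (intro mult_left_mono b) simp
    finally show ?thesis by (simp add: power2_eq_square mult_ac)
  qed
  with b(1) show ?thesis by blast
qed

text \<open>
  The difference of the forms is at least \<open>m * (norm u)^2\<close> with \<open>m > 0\<close>, whereas the larger one is at
  most \<open>b * (norm u)^2\<close>.
\<close>

lemma strict_form_contraction:
  fixes X Y :: "real^'n^'n"
  assumes pos: "\<And>u. u \<noteq> 0 \<Longrightarrow> 0 < u \<bullet> (X *v u)"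
    and less: "\<And>u. u \<noteq> 0 \<Longrightarrow> u \<bullet> (Y *v u) < u \<bullet> (X *v u)"
  shows "\<exists>e\<in>{0<..<1}. \<forall>u. u \<bullet> (Y *v u) \<le> e * (u \<bullet> (X *v u))"
proof -
  obtain m where m: "m > 0" "\<And>u. m * (norm u)\<^sup>2 \<le> u \<bullet> ((X - Y) *v u)"
    using coercive_quadratic_form[of "X - Y"] less
    by (auto simp: matrix_vector_mult_diff_rdistrib inner_diff_right)
  obtain b where b: "b > 0" "\<And>u. u \<bullet> (X *v u) \<le> b * (norm u)\<^sup>2"
    using bounded_quadratic_form[of X] by blast
  \<comment> \<open>The more natural factor \<open>1 - m / b\<close> need not be positive.\<close>
  define e where "e = 1 - m / (b + m)"
  have e: "e \<in> {0<..<1}" using m(1) b(1) by (simp add: e_def field_simps)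
  have "u \<bullet> (Y *v u) \<le> e * (u \<bullet> (X *v u))" for u
  proof -
    have X: "0 \<le> u \<bullet> (X *v u)" using pos[of u] by (cases "u = 0") auto
    have "m / (b + m) * (u \<bullet> (X *v u)) \<le> m / b * (u \<bullet> (X *v u))"
      using m(1) b(1) X by (intro mult_right_mono divide_left_mono) auto
    also have "\<dots> \<le> m / b * (b * (norm u)\<^sup>2)"
      using m(1) b by (intro mult_left_mono) auto
    also have "\<dots> = m * (norm u)\<^sup>2" using b(1) by simp
    also have "\<dots> \<le> u \<bullet> (X *v u) - u \<bullet> (Y *v u)"
      using m(2)[of u] by (simp add: matrix_vector_mult_diff_rdistrib inner_diff_right)
    finally show ?thesis by (simp add: e_def algebra_simps)
  qed
  with e show ?thesis by blast
qed

lemma dominated_by_positive_form: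
  fixes X H :: "real^'n^'n"
  assumes "\<And>u. u \<noteq> 0 \<Longrightarrow> 0 < u \<bullet> (X *v u)"
  shows "\<exists>b>0. \<forall>u x. ((transpose H *v u) \<bullet> x)\<^sup>2 \<le> b * (norm x)\<^sup>2 * (u \<bullet> (X *v u))"
proof -
  obtain m where m: "m > 0" "\<And>u. m * (norm u)\<^sup>2 \<le> u \<bullet> (X *v u)"
    using coercive_quadratic_form[OF assms] by blast
  obtain a where a: "a > 0" "\<And>u. norm (transpose H *v u) \<le> norm u * a"
    using bounded_linear.pos_bounded[OF matrix_vector_mul_bounded_linear] by blast
  have "((transpose H *v u) \<bullet> x)\<^sup>2 \<le> (a\<^sup>2 / m) * (norm x)\<^sup>2 * (u \<bullet> (X *v u))" for u x
  proof -
    have "\<bar>(transpose H *v u) \<bullet> x\<bar> \<le> norm (transpose H *v u) * norm x"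
      by (rule Cauchy_Schwarz_ineq2)
    also have "\<dots> \<le> norm u * a * norm x" by (intro mult_right_mono a) simp
    finally have "((transpose H *v u) \<bullet> x)\<^sup>2 \<le> (norm u * a * norm x)\<^sup>2"
      by (metis abs_ge_zero power2_abs power_mono)
    also have "\<dots> = (a\<^sup>2 / m) * (norm x)\<^sup>2 * (m * (norm u)\<^sup>2)"
      using m(1) by (simp add: power_mult_distrib)
    also have "\<dots> \<le> (a\<^sup>2 / m) * (norm x)\<^sup>2 * (u \<bullet> (X *v u))"
      using m by (intro mult_left_mono) auto
    finally show ?thesis .
  qed
  moreover have "a\<^sup>2 / m > 0" using a m by simp
  ultimately show ?thesis by blast
qed

section \<open>Second moments of linear systems driven by a finite chain\<close>

text \<open>
  The Markov property is expressed through probabilities of finite histories instead of conditional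
  probabilities, so that histories of probability zero need no separate treatment.
\<close>

locale finite_state_chain = prob_space +
  fixes S :: "'c set" and P :: "'c \<Rightarrow> 'c \<Rightarrow> real" and c :: "nat \<Rightarrow> 'a \<Rightarrow> 'c"
  assumes finite_states: "finite S"
    and trans_nonneg: "i \<in> S \<Longrightarrow> j \<in> S \<Longrightarrow> 0 \<le> P i j"
    and chain_measurable: "c k \<in> measurable M (count_space S)"
    and path_law: "(\<And>l. l \<le> Suc k \<Longrightarrow> h l \<in> S) \<Longrightarrow>
      prob {\<omega> \<in> space M. \<forall>l\<le>Suc k. c l \<omega> = h l} =
      prob {\<omega> \<in> space M. \<forall>l\<le>k. c l \<omega> = h l} * P (h k) (h (Suc k))"
begin

abbreviation "hist k h \<equiv> {\<omega> \<in> space M. \<forall>l\<le>k. c l \<omega> = h l}"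

lemma chain_in_states: "\<omega> \<in> space M \<Longrightarrow> c k \<omega> \<in> S"
  using measurable_space[OF chain_measurable] by simp

lemma hist_sets: "hist k h \<in> events"
proof -
  note chain_measurable[measurable]
  have "hist k h = (\<Inter>l\<in>{..k}. c l -` {h l} \<inter> space M)" by auto
  also have "\<dots> = (\<Inter>l\<in>{..k}. c l -` ({h l} \<inter> S) \<inter> space M)"
    using chain_in_states by blast
  also have "\<dots> \<in> events"
    by (intro sets.finite_INT measurable_sets[OF chain_measurable]) auto
  finally show ?thesis .
qed

lemma integrable_mult_hist: "integrable M (\<lambda>\<omega>. a * indicator (hist k h) \<omega> :: real)"
  by (intro integrable_mult_right integrable_real_indicator hist_sets)
     (simp add: emeasure_eq_measure)

lemma integral_mult_hist: "(\<integral>\<omega>. a * indicator (hist k h) \<omega> \<partial>M) = a * prob (hist k h)"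
  by (subst integral_mult_right_zero, subst Bochner_Integration.integral_indicator)
     (simp_all only: Int_absorb2[OF sets.sets_into_space[OF hist_sets]] hist_sets)

text \<open>
  There are only finitely many histories up to time \<open>k\<close>, so that a function of the history is a
  simple function.  Integrability and all expectations below reduce to finite sums in this way.
\<close>

lemma history_decomposition:
  fixes f :: "(nat \<Rightarrow> 'c) \<Rightarrow> real"
  assumes f: "\<And>h h'. (\<And>l. l \<le> k \<Longrightarrow> h l = h' l) \<Longrightarrow> f h = f h'"
    and \<omega>: "\<omega> \<in> space M"
  shows "f (\<lambda>l. c l \<omega>) = (\<Sum>h\<in>PiE {..k} (\<lambda>_. S). f h * indicator (hist k h) \<omega>)"
proof -
  let ?h = "restrict (\<lambda>l. c l \<omega>) {..k}"
  have h: "?h \<in> PiE {..k} (\<lambda>_. S)" using chain_in_states[OF \<omega>] by auto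
  have "indicator (hist k h) \<omega> = (if h = ?h then 1 else 0::real)"
    if "h \<in> PiE {..k} (\<lambda>_. S)" for h
    using \<omega> that by (auto simp: indicator_def fun_eq_iff PiE_def extensional_def)
  then have "(\<Sum>h\<in>PiE {..k} (\<lambda>_. S). f h * indicator (hist k h) \<omega>) =
      (\<Sum>h\<in>PiE {..k} (\<lambda>_. S). if h = ?h then f h else 0)"
    by (intro sum.cong) auto
  also have "\<dots> = f ?h" using h by (simp add: finite_PiE finite_states)
  also have "\<dots> = f (\<lambda>l. c l \<omega>)" by (rule f) simp
  finally show ?thesis by simp
qed

lemma history_expectation:
  fixes f :: "(nat \<Rightarrow> 'c) \<Rightarrow> real"
  assumes f: "\<And>h h'. (\<And>l. l \<le> k \<Longrightarrow> h l = h' l) \<Longrightarrow> f h = f h'"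
  shows "integrable M (\<lambda>\<omega>. f (\<lambda>l. c l \<omega>))"
    and "(\<integral>\<omega>. f (\<lambda>l. c l \<omega>) \<partial>M) = (\<Sum>h\<in>PiE {..k} (\<lambda>_. S). f h * prob (hist k h))"
proof -
  have int: "integrable M (\<lambda>\<omega>. f h * indicator (hist k h) \<omega>)" for h
    by (rule integrable_mult_hist)
  have "integrable M (\<lambda>\<omega>. \<Sum>h\<in>PiE {..k} (\<lambda>_. S). f h * indicator (hist k h) \<omega>)"
    by (intro Bochner_Integration.integrable_sum int)
  then show "integrable M (\<lambda>\<omega>. f (\<lambda>l. c l \<omega>))"
    by (subst Bochner_Integration.integrable_cong[OF refl history_decomposition[OF f]])
  have "(\<integral>\<omega>. f (\<lambda>l. c l \<omega>) \<partial>M) =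
      (\<integral>\<omega>. (\<Sum>h\<in>PiE {..k} (\<lambda>_. S). f h * indicator (hist k h) \<omega>) \<partial>M)"
    by (intro Bochner_Integration.integral_cong refl history_decomposition f)
  also have "\<dots> = (\<Sum>h\<in>PiE {..k} (\<lambda>_. S). \<integral>\<omega>. f h * indicator (hist k h) \<omega> \<partial>M)"
    by (intro Bochner_Integration.integral_sum int)
  also have "\<dots> = (\<Sum>h\<in>PiE {..k} (\<lambda>_. S). f h * prob (hist k h))"
    by (simp only: integral_mult_hist)
  finally show "(\<integral>\<omega>. f (\<lambda>l. c l \<omega>) \<partial>M) = (\<Sum>h\<in>PiE {..k} (\<lambda>_. S). f h * prob (hist k h))" .
qed

text \<open>
  The Markov property in the form in which it drives the moment recursion, with the past entering
  as a weight.  By linearity it suffices to take for \<open>f\<close> the indicator of one history, where it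
  is \<open>path_law\<close>.
\<close>

lemma expectation_next_state:
  fixes f :: "(nat \<Rightarrow> 'c) \<Rightarrow> real"
  assumes f: "\<And>h h'. (\<And>l. l \<le> k \<Longrightarrow> h l = h' l) \<Longrightarrow> f h = f h'" and j: "j \<in> S"
  shows "(\<integral>\<omega>. f (\<lambda>l. c l \<omega>) * of_bool (c (Suc k) \<omega> = j) \<partial>M) =
         (\<integral>\<omega>. f (\<lambda>l. c l \<omega>) * P (c k \<omega>) j \<partial>M)"
proof -
  let ?H = "PiE {..k} (\<lambda>_. S)"
  have int: "integrable M (\<lambda>\<omega>. f h * indicator (hist (Suc k) (h(Suc k := j))) \<omega>)" for h
    by (rule integrable_mult_hist)
  have "(\<integral>\<omega>. f (\<lambda>l. c l \<omega>) * of_bool (c (Suc k) \<omega> = j) \<partial>M) =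
      (\<integral>\<omega>. (\<Sum>h\<in>?H. f h * indicator (hist (Suc k) (h(Suc k := j))) \<omega>) \<partial>M)"
  proof (intro Bochner_Integration.integral_cong refl)
    fix \<omega> assume \<omega>: "\<omega> \<in> space M"
    have dec: "f (\<lambda>l. c l \<omega>) = (\<Sum>h\<in>?H. f h * indicator (hist k h) \<omega>)"
      using f \<omega> by (rule history_decomposition)
    have ind: "indicator (hist k h) \<omega> * of_bool (c (Suc k) \<omega> = j) =
        (indicator (hist (Suc k) (h(Suc k := j))) \<omega> :: real)" for h
      using \<omega> by (auto simp: indicator_def le_Suc_eq)
    show "f (\<lambda>l. c l \<omega>) * of_bool (c (Suc k) \<omega> = j) =
        (\<Sum>h\<in>?H. f h * indicator (hist (Suc k) (h(Suc k := j))) \<omega>)"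
      unfolding dec sum_distrib_right mult.assoc
      by (intro sum.cong refl arg_cong2[where f = "(*)"] ind)
  qed
  also have "\<dots> = (\<Sum>h\<in>?H. \<integral>\<omega>. f h * indicator (hist (Suc k) (h(Suc k := j))) \<omega> \<partial>M)"
    by (intro Bochner_Integration.integral_sum int)
  also have "\<dots> = (\<Sum>h\<in>?H. f h * prob (hist (Suc k) (h(Suc k := j))))"
    by (simp only: integral_mult_hist)
  also have "\<dots> = (\<Sum>h\<in>?H. (f h * P (h k) j) * prob (hist k h))"
  proof (intro sum.cong refl)
    fix h assume h: "h \<in> ?H"
    have "hist k (h(Suc k := j)) = hist k h" by auto
    moreover have "prob (hist (Suc k) (h(Suc k := j))) =
        prob (hist k (h(Suc k := j))) * P ((h(Suc k := j)) k) ((h(Suc k := j)) (Suc k))"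
      using h j by (intro path_law) (auto simp: PiE_iff)
    ultimately show "f h * prob (hist (Suc k) (h(Suc k := j))) = f h * P (h k) j * prob (hist k h)"
      by simp
  qed
  also have "\<dots> = (\<integral>\<omega>. f (\<lambda>l. c l \<omega>) * P (c k \<omega>) j \<partial>M)"
    by (rule history_expectation(2)[symmetric, of k "\<lambda>h. f h * P (h k) j"]) (metis f order_refl)
  finally show ?thesis .
qed

end

primrec jump_trajectory ::
    "('c \<Rightarrow> real^'n^'n) \<Rightarrow> real^'n \<Rightarrow> (nat \<Rightarrow> 'c) \<Rightarrow> nat \<Rightarrow> real^'n" where
  "jump_trajectory H x0 h 0 = x0"
| "jump_trajectory H x0 h (Suc k) = H (h k) *v jump_trajectory H x0 h k"

text \<open>
  The strict bound reflects that the state at time \<open>k\<close> is determined by the modes before \<open>k\<close>; in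
  particular \<open>x k\<close> is a function of the history up to time \<open>k\<close>.
\<close>

lemma jump_trajectory_cong:
  "(\<And>l. l < k \<Longrightarrow> h l = h' l) \<Longrightarrow> jump_trajectory H x0 h k = jump_trajectory H x0 h' k"
  by (induction k) auto

context finite_state_chain
begin

definition second_moment :: "('c \<Rightarrow> real^'n^'n) \<Rightarrow> real^'n \<Rightarrow> nat \<Rightarrow> 'c \<Rightarrow> real^'n \<Rightarrow> real" where
  "second_moment H x0 k i v =
     (\<integral>\<omega>. (v \<bullet> jump_trajectory H x0 (\<lambda>l. c l \<omega>) k)\<^sup>2 * of_bool (c k \<omega> = i) \<partial>M)"

lemma second_moment_integrable:
  "integrable M (\<lambda>\<omega>. (v \<bullet> jump_trajectory H x0 (\<lambda>l. c l \<omega>) k)\<^sup>2 * of_bool (c k \<omega> = i))"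
  by (rule history_expectation(1)[of k
        "\<lambda>h. (v \<bullet> jump_trajectory H x0 h k)\<^sup>2 * of_bool (h k = i)"])
     (metis jump_trajectory_cong less_imp_le order_refl)

lemma split_by_state:
  "\<omega> \<in> space M \<Longrightarrow> g (c k \<omega>) = (\<Sum>i\<in>S. g i * of_bool (c k \<omega> = i) :: real)"
  using chain_in_states[of \<omega> k] by (simp add: finite_states if_distrib of_bool_def cong: if_cong)

lemma inner_next_state:
  "v \<bullet> jump_trajectory H x0 h (Suc k) = (transpose (H (h k)) *v v) \<bullet> jump_trajectory H x0 h k"
  by (metis dot_lmul_matrix jump_trajectory.simps(2) transpose_matrix_vector)

lemma second_moment_Suc:
  assumes "j \<in> S"
  shows "second_moment H x0 (Suc k) j v =
    (\<Sum>i\<in>S. P i j * second_moment H x0 k i (transpose (H i) *v v))"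
proof -
  let ?x = "\<lambda>\<omega>. jump_trajectory H x0 (\<lambda>l. c l \<omega>) k"
  have "second_moment H x0 (Suc k) j v =
      (\<integral>\<omega>. (v \<bullet> jump_trajectory H x0 (\<lambda>l. c l \<omega>) (Suc k))\<^sup>2 * P (c k \<omega>) j \<partial>M)"
    unfolding second_moment_def
    by (rule expectation_next_state[OF _ assms, of k
          "\<lambda>h. (v \<bullet> jump_trajectory H x0 h (Suc k))\<^sup>2"])
       (metis jump_trajectory_cong less_Suc_eq_le)
  also have "\<dots> = (\<integral>\<omega>. (\<Sum>i\<in>S. P i j *
      (((transpose (H i) *v v) \<bullet> ?x \<omega>)\<^sup>2 * of_bool (c k \<omega> = i))) \<partial>M)"
  proof (intro Bochner_Integration.integral_cong refl)
    fix \<omega> assume "\<omega> \<in> space M"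
    from split_by_state[OF this, of "\<lambda>i. ((transpose (H i) *v v) \<bullet> ?x \<omega>)\<^sup>2 * P i j" k]
    show "(v \<bullet> jump_trajectory H x0 (\<lambda>l. c l \<omega>) (Suc k))\<^sup>2 * P (c k \<omega>) j =
        (\<Sum>i\<in>S. P i j * (((transpose (H i) *v v) \<bullet> ?x \<omega>)\<^sup>2 * of_bool (c k \<omega> = i)))"
      unfolding inner_next_state by (simp add: mult_ac)
  qed
  also have "\<dots> = (\<Sum>i\<in>S. P i j * second_moment H x0 k i (transpose (H i) *v v))"
    unfolding second_moment_def
    by (subst Bochner_Integration.integral_sum)
       (auto intro!: second_moment_integrable)
  finally show ?thesis .
qed

text \<open>
  The induction has to be carried out for the vectors \<open>transpose (H i) *v u\<close> rather than for
  all \<open>v\<close>: there the bound is by \<open>R i\<close> and holds at \<open>k = 0\<close>, whereas a bound of \<open>second_moment\<close> at \<open>v\<close> by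
  the weighted sum of the \<open>R i'\<close> may fail at time \<open>0\<close>, when that sum is singular.
\<close>

lemma second_moment_decay:
  assumes \<kappa>: "\<kappa> \<ge> 0" and e: "e \<ge> 0"
    and init: "\<And>i u x. i \<in> S \<Longrightarrow>
      ((transpose (H i) *v u) \<bullet> x)\<^sup>2 \<le> \<kappa> * (norm x)\<^sup>2 * (u \<bullet> (R i *v u))"
    and contr: "\<And>i u. i \<in> S \<Longrightarrow>
      (transpose (H i) *v u) \<bullet> ((\<Sum>i'\<in>S. P i' i *\<^sub>R R i') *v (transpose (H i) *v u))
        \<le> e * (u \<bullet> (R i *v u))"
    and i: "i \<in> S"
  shows "second_moment H x0 k i (transpose (H i) *v u)
    \<le> \<kappa> * e ^ k * (norm x0)\<^sup>2 * (u \<bullet> (R i *v u))"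
  using i
proof (induction k arbitrary: i u)
  case 0
  have "second_moment H x0 0 i (transpose (H i) *v u) \<le>
      (\<integral>\<omega>. ((transpose (H i) *v u) \<bullet> x0)\<^sup>2 \<partial>M)"
    unfolding second_moment_def
    by (intro integral_mono second_moment_integrable) auto
  also have "\<dots> = ((transpose (H i) *v u) \<bullet> x0)\<^sup>2" by (simp add: prob_space)
  also have "\<dots> \<le> \<kappa> * (norm x0)\<^sup>2 * (u \<bullet> (R i *v u))" by (rule init[OF 0])
  finally show ?case by simp
next
  case (Suc k)
  let ?v = "transpose (H i) *v u" and ?d = "\<kappa> * e ^ k * (norm x0)\<^sup>2"
  have "second_moment H x0 (Suc k) i ?v =
      (\<Sum>i'\<in>S. P i' i * second_moment H x0 k i' (transpose (H i') *v ?v))"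
    by (rule second_moment_Suc[OF Suc.prems])
  also have "\<dots> \<le> (\<Sum>i'\<in>S. P i' i * (?d * (?v \<bullet> (R i' *v ?v))))"
    by (intro sum_mono mult_left_mono Suc.IH trans_nonneg Suc.prems)
  also have "\<dots> = ?d * (?v \<bullet> ((\<Sum>i'\<in>S. P i' i *\<^sub>R R i') *v ?v))"
  proof -
    have "(\<Sum>i'\<in>S. P i' i *\<^sub>R R i') *v ?v = (\<Sum>i'\<in>S. P i' i *\<^sub>R (R i' *v ?v))"
      using finite_states
      by (induction S rule: finite_induct)
         (simp_all add: matrix_vector_mult_add_rdistrib scaleR_matrix_vector_assoc)
    then show ?thesis by (simp add: inner_sum_right sum_distrib_left mult_ac)
  qed
  also have "\<dots> \<le> ?d * (e * (u \<bullet> (R i *v u)))"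
    using \<kappa> e by (intro mult_left_mono contr Suc.prems) auto
  finally show ?case by (simp add: mult_ac)
qed

text \<open>
  Since \<open>x (m + 1) = H (c m) *v x m\<close>, the squared norm of \<open>x (m + 1)\<close> is a sum of the moments
  controlled by \<open>second_moment_decay\<close> at time \<open>m\<close>.  This shift by one step is the reason for the
  factor \<open>1 / e\<close> in \<open>C\<close>; the summand \<open>1\<close> serves \<open>k = 0\<close>.
\<close>

lemma mean_square_decay:
  fixes H R :: "'c \<Rightarrow> real^'n^'n"
  assumes \<kappa>: "\<kappa> \<ge> 0" and e: "e > 0"
    and pos: "\<And>i u. i \<in> S \<Longrightarrow> 0 \<le> u \<bullet> (R i *v u)"
    and init: "\<And>i u x. i \<in> S \<Longrightarrow>
      ((transpose (H i) *v u) \<bullet> x)\<^sup>2 \<le> \<kappa> * (norm x)\<^sup>2 * (u \<bullet> (R i *v u))"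
    and contr: "\<And>i u. i \<in> S \<Longrightarrow>
      (transpose (H i) *v u) \<bullet> ((\<Sum>i'\<in>S. P i' i *\<^sub>R R i') *v (transpose (H i) *v u))
        \<le> e * (u \<bullet> (R i *v u))"
  defines "C \<equiv> 1 + \<kappa> / e * (\<Sum>i\<in>S. \<Sum>b\<in>Basis. b \<bullet> (R i *v b))"
  shows "integrable M (\<lambda>\<omega>. (norm (jump_trajectory H x0 (\<lambda>l. c l \<omega>) k))\<^sup>2)"
    and "(\<integral>\<omega>. (norm (jump_trajectory H x0 (\<lambda>l. c l \<omega>) k))\<^sup>2 \<partial>M) \<le> C * e ^ k * (norm x0)\<^sup>2"
proof -
  let ?x = "\<lambda>k \<omega>. jump_trajectory H x0 (\<lambda>l. c l \<omega>) k"
  show "integrable M (\<lambda>\<omega>. (norm (?x k \<omega>))\<^sup>2)"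
    by (rule history_expectation(1)[of k "\<lambda>h. (norm (jump_trajectory H x0 h k))\<^sup>2"])
       (metis jump_trajectory_cong less_imp_le)
  have tr: "0 \<le> (\<Sum>i\<in>S. \<Sum>b\<in>Basis. b \<bullet> (R i *v b))"
    by (intro sum_nonneg pos)
  then have C: "C \<ge> 1" using \<kappa> e by (simp add: C_def)
  show "(\<integral>\<omega>. (norm (?x k \<omega>))\<^sup>2 \<partial>M) \<le> C * e ^ k * (norm x0)\<^sup>2"
  proof (cases k)
    case 0
    then show ?thesis using mult_right_mono[OF C, of "(norm x0)\<^sup>2"] by (simp add: prob_space)
  next
    case (Suc m)
    have "(\<integral>\<omega>. (norm (?x k \<omega>))\<^sup>2 \<partial>M) = (\<integral>\<omega>. (\<Sum>i\<in>S. \<Sum>b\<in>Basis.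
        ((transpose (H i) *v b) \<bullet> ?x m \<omega>)\<^sup>2 * of_bool (c m \<omega> = i)) \<partial>M)"
    proof (intro Bochner_Integration.integral_cong refl)
      fix \<omega> assume \<omega>: "\<omega> \<in> space M"
      have "(norm (?x k \<omega>))\<^sup>2 = (\<Sum>b\<in>Basis. (b \<bullet> ?x (Suc m) \<omega>)\<^sup>2)"
        unfolding Suc power2_norm_eq_inner
        by (subst euclidean_inner) (simp add: power2_eq_square inner_commute)
      also have "\<dots> = (\<Sum>b\<in>Basis. ((transpose (H (c m \<omega>)) *v b) \<bullet> ?x m \<omega>)\<^sup>2)"
        unfolding inner_next_state ..
      also have "\<dots> = (\<Sum>i\<in>S. (\<Sum>b\<in>Basis. ((transpose (H i) *v b) \<bullet> ?x m \<omega>)\<^sup>2) * of_bool (c m \<omega> = i))"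
        by (rule split_by_state[OF \<omega>, of "\<lambda>i. \<Sum>b\<in>Basis. ((transpose (H i) *v b) \<bullet> ?x m \<omega>)\<^sup>2"])
      finally show "(norm (?x k \<omega>))\<^sup>2 = (\<Sum>i\<in>S. \<Sum>b\<in>Basis.
          ((transpose (H i) *v b) \<bullet> ?x m \<omega>)\<^sup>2 * of_bool (c m \<omega> = i))"
        by (simp add: sum_distrib_right)
    qed
    also have "\<dots> = (\<Sum>i\<in>S. \<Sum>b\<in>Basis. second_moment H x0 m i (transpose (H i) *v b))"
      unfolding second_moment_def
      by (subst Bochner_Integration.integral_sum,
          intro Bochner_Integration.integrable_sum second_moment_integrable,
          intro sum.cong refl Bochner_Integration.integral_sum second_moment_integrable)
    also have "\<dots> \<le> (\<Sum>i\<in>S. \<Sum>b\<in>Basis. \<kappa> * e ^ m * (norm x0)\<^sup>2 * (b \<bullet> (R i *v b)))"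
      by (intro sum_mono second_moment_decay \<kappa> less_imp_le[OF e] init contr)
    also have "\<dots> = (C - 1) * e ^ k * (norm x0)\<^sup>2"
      using e by (simp add: C_def Suc sum_distrib_left sum_distrib_right mult_ac)
    also have "\<dots> \<le> C * e ^ k * (norm x0)\<^sup>2"
      using e by (intro mult_right_mono) auto
    finally show ?thesis .
  qed
qed

end

section \<open>The extended mode along a sample path\<close>

lemma wrap_range: "T > 0 \<Longrightarrow> wrap T k \<in> {1..T}"
  by (simp add: wrap_eq Suc_le_eq nat_less_iff)

lemma wrap_Suc: "T > 0 \<Longrightarrow> wrap T (int (wrap T k) + 1) = wrap T (k + 1)"
  by (simp add: wrap_eq mod_simps)

lemma wrap_one: "T > 0 \<Longrightarrow> wrap T 1 = 1"
  by (simp add: wrap_eq)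

definition ext_next :: "nat set \<Rightarrow> nat \<Rightarrow> nat \<Rightarrow> nat \<Rightarrow> ext_mode \<Rightarrow> ext_mode" where
  "ext_next \<Lambda> T \<alpha>' \<beta>' =
     (\<lambda>(\<alpha>, \<beta>, \<gamma>, \<delta>). if \<beta>' \<in> \<Lambda> then (\<alpha>', \<beta>', \<alpha>', 1) else (\<alpha>', \<beta>', \<gamma>, wrap T (int \<delta> + 1)))"

lemma ext_trans_eq:
  "ext_trans p q \<Lambda> T c c' = of_bool (c' = ext_next \<Lambda> T (fst c') (fst (snd c')) c) *
     p (fst c) (fst c') * q (fst (snd c)) (fst (snd c'))"
  by (cases c; cases c') (auto simp: ext_trans_def ext_next_def)

lemma ext_next_fst [simp]:
  "fst (ext_next \<Lambda> T a b c) = a" "fst (snd (ext_next \<Lambda> T a b c)) = b"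
  by (cases c; simp add: ext_next_def)+

lemma ext_next_in_ext_modes:
  "T > 0 \<Longrightarrow> a \<in> {1..N} \<Longrightarrow> b \<in> {1..M} \<Longrightarrow> fst (snd (snd c)) \<in> {1..N} \<Longrightarrow>
     ext_next \<Lambda> T a b c \<in> ext_modes N M T"
  using wrap_range[of T] by (cases c) (auto simp: ext_next_def ext_modes_def)

text \<open>
  The argument \<open>z\<close> is a fictitious extended mode at time \<open>- 1\<close> that carries the initial guesses for
  the last observed mode and the age of the observation.  Starting one step early lets a single rule
  cover both an observation at time \<open>0\<close> and its absence.
\<close>

primrec ext_path ::
    "nat set \<Rightarrow> nat \<Rightarrow> ext_mode \<Rightarrow> (nat \<Rightarrow> nat) \<Rightarrow> (nat \<Rightarrow> nat) \<Rightarrow> nat \<Rightarrow> ext_mode" where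
  "ext_path \<Lambda> T z \<rho> y 0 = ext_next \<Lambda> T (\<rho> 0) (y 0) z"
| "ext_path \<Lambda> T z \<rho> y (Suc k) = ext_next \<Lambda> T (\<rho> (Suc k)) (y (Suc k)) (ext_path \<Lambda> T z \<rho> y k)"

lemma ext_path_fst [simp]:
  "fst (ext_path \<Lambda> T z \<rho> y k) = \<rho> k" "fst (snd (ext_path \<Lambda> T z \<rho> y k)) = y k"
  by (cases k; simp)+

lemma ext_path_in_ext_modes:
  assumes "T > 0" "\<And>k. \<rho> k \<in> {1..N}" "\<And>k. y k \<in> {1..M}" "fst (snd (snd z)) \<in> {1..N}"
  shows "ext_path \<Lambda> T z \<rho> y k \<in> ext_modes N M T"
proof (induction k)
  case 0
  then show ?case using assms by (simp add: ext_next_in_ext_modes)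
next
  case (Suc k)
  then have "fst (snd (snd (ext_path \<Lambda> T z \<rho> y k))) \<in> {1..N}"
    by (auto simp: ext_modes_def)
  with assms show ?case by (simp add: ext_next_in_ext_modes)
qed

lemma ext_path_cong:
  "(\<And>l. l \<le> k \<Longrightarrow> \<rho> l = \<rho>' l \<and> y l = y' l) \<Longrightarrow> ext_path \<Lambda> T z \<rho> y k = ext_path \<Lambda> T z \<rho>' y' k"
  by (induction k) auto

text \<open>
  An extended history contains the histories of both chains, and conversely they determine it.  Hence
  the event that the extended path follows \<open>h\<close> is an event about the two chains, or empty if \<open>h\<close>
  violates the recursion.
\<close>

lemma ext_path_history_iff:
  "(\<forall>l\<le>k. ext_path \<Lambda> T z \<rho> y l = h l) \<longleftrightarrow>
     (\<forall>l\<le>k. \<rho> l = fst (h l) \<and> y l = fst (snd (h l))) \<and>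
     (\<forall>l\<le>k. ext_path \<Lambda> T z (\<lambda>l. fst (h l)) (\<lambda>l. fst (snd (h l))) l = h l)"
proof -
  have eq: "ext_path \<Lambda> T z \<rho> y l = ext_path \<Lambda> T z (\<lambda>l. fst (h l)) (\<lambda>l. fst (snd (h l))) l"
    if "\<forall>l\<le>k. \<rho> l = fst (h l) \<and> y l = fst (snd (h l))" "l \<le> k" for l
    using that by (intro ext_path_cong) auto
  have "\<rho> l = fst (h l) \<and> y l = fst (snd (h l))"
    if "\<forall>l\<le>k. ext_path \<Lambda> T z \<rho> y l = h l" "l \<le> k" for l
    using that by (metis ext_path_fst)
  with eq show ?thesis by metis
qed

text \<open>
  With \<open>\<delta> = wrap T (- \<tau>0)\<close> at the fictitious time \<open>- 1\<close>, the counter without an observation reads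
  \<open>wrap T (k + 1 - \<tau>0)\<close> at time \<open>k\<close>, as required.  Infinitely many visits are needed because
  the values of \<^const>\<open>enumerate\<close> beyond the last element of a finite set are unspecified.
\<close>

lemma ext_path_eq_observation:
  fixes y \<rho> :: "nat \<Rightarrow> nat" and \<tau>0 :: int
  assumes T: "T > 0" and inf: "infinite {k. y k \<in> \<Lambda>}"
  defines "t \<equiv> enumerate {k. y k \<in> \<Lambda>}"
  shows "ext_path \<Lambda> T (1, 1, \<sigma>0, wrap T (- \<tau>0)) \<rho> y k =
    (\<rho> k, y k, last_obs_mode t \<rho> \<sigma>0 k, wrap T (int k + 1 - last_obs_time t \<tau>0 k))"
proof -
  \<comment> \<open>The observation times up to \<open>k\<close>; both observation functions depend on \<open>t\<close> only through them.\<close>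
  define V where "V k = {l. y l \<in> \<Lambda> \<and> l \<le> k}" for k
  have fin: "finite (V k)" for k
    by (rule finite_subset[of _ "{..k}"]) (auto simp: V_def)
  have "range t = {k. y k \<in> \<Lambda>}" unfolding t_def by (rule range_enumerate[OF inf])
  then have "{t i | i. t i \<le> k} = V k" for k
    unfolding V_def by (auto simp: set_eq_iff image_iff)
  note tO = this
  have t0: "t 0 \<le> k \<longleftrightarrow> V k \<noteq> {}" for k
  proof -
    have "strict_mono t" unfolding t_def by (rule strict_mono_enumerate[OF inf])
    then have "t 0 \<le> t i" for i by (simp add: strict_mono_less_eq)
    then show ?thesis unfolding tO[symmetric] by (auto intro: order_trans)
  qed
  have mode: "last_obs_mode t \<rho> \<sigma>0 k = (if V k = {} then \<sigma>0 else \<rho> (Max (V k)))"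
    and time: "last_obs_time t \<tau>0 k = (if V k = {} then \<tau>0 else int (Max (V k)))" for k
    by (simp_all add: last_obs_mode_def last_obs_time_def t0 tO)
  have hit: "V k \<noteq> {}" "Max (V k) = k" if "y k \<in> \<Lambda>" for k
  proof -
    show "Max (V k) = k" using that fin by (intro Max_eqI) (auto simp: V_def)
    show "V k \<noteq> {}" using that by (auto simp: V_def)
  qed
  have miss0: "V 0 = {}" if "y 0 \<notin> \<Lambda>" using that by (auto simp: V_def)
  have miss: "V (Suc k) = V k" if "y (Suc k) \<notin> \<Lambda>" for k
    using that by (auto simp: V_def le_Suc_eq)
  show ?thesis
  proof (induction k)
    case 0
    show ?case
      using hit[of 0] miss0 T wrap_one wrap_Suc[OF T, of "- \<tau>0"]
      by (cases "y 0 \<in> \<Lambda>") (simp_all add: ext_next_def mode time)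
  next
    case (Suc k)
    have "wrap T (int (wrap T (int k + 1 - last_obs_time t \<tau>0 k)) + 1) =
        wrap T (int (Suc k) + 1 - last_obs_time t \<tau>0 k)"
      unfolding wrap_Suc[OF T] by (simp add: algebra_simps)
    then show ?case
      using hit[of "Suc k"] miss[of k] wrap_one[OF T] Suc
      by (cases "y (Suc k) \<in> \<Lambda>") (simp_all add: ext_next_def mode time)
  qed
qed

lemma closed_loop_eq_jump_trajectory:
  assumes T: "T > 0" and inf: "infinite {k. y k \<in> \<Lambda>}"
  shows "closed_loop A B T K \<rho> (enumerate {k. y k \<in> \<Lambda>}) \<tau>0 \<sigma>0 x0 k =
    jump_trajectory (\<lambda>(\<alpha>, \<beta>, \<gamma>, \<delta>). A \<alpha> + B \<alpha> ** K \<gamma> \<delta>) x0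
      (ext_path \<Lambda> T (1, 1, \<sigma>0, wrap T (- \<tau>0)) \<rho> y) k"
  by (induction k) (simp_all add: ext_path_eq_observation[OF T inf] del: ext_path.simps One_nat_def)

section \<open>The extended mode is a Markov chain\<close>

lemma (in prob_space) markov_chain_path:
  assumes mc: "markov_chain M N p i0 X" and h: "h (Suc k) \<in> {1..N}"
  shows "prob {\<omega> \<in> space M. \<forall>l\<le>Suc k. X l \<omega> = h l} =
    prob {\<omega> \<in> space M. \<forall>l\<le>k. X l \<omega> = h l} * p (h k) (h (Suc k))"
proof -
  have split: "{\<omega> \<in> space M. \<forall>l\<le>Suc k. X l \<omega> = h l} =
      {\<omega> \<in> space M. X (Suc k) \<omega> = h (Suc k) \<and> (\<forall>l\<le>k. X l \<omega> = h l)}"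
    by (auto simp: le_Suc_eq)
  have X: "X l \<in> measurable M (count_space {1..N})" for l
    using mc by (simp add: markov_chain_def)
  have set: "{\<omega> \<in> space M. \<forall>l\<le>k. X l \<omega> = h l} \<in> events"
  proof -
    have "{\<omega> \<in> space M. \<forall>l\<le>k. X l \<omega> = h l} = (\<Inter>l\<in>{..k}. X l -` ({h l} \<inter> {1..N}) \<inter> space M)"
      using measurable_space[OF X] by auto
    also have "\<dots> \<in> events"
      by (intro sets.finite_INT measurable_sets[OF X]) auto
    finally show ?thesis .
  qed
  show ?thesis
  proof (cases "prob {\<omega> \<in> space M. \<forall>l\<le>k. X l \<omega> = h l} > 0")
    case True
    then have "cond_prob M (\<lambda>\<omega>. X (Suc k) \<omega> = h (Suc k)) (\<lambda>\<omega>. \<forall>l\<le>k. X l \<omega> = h l) = p (h k) (h (Suc k))"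
      using mc h by (simp add: markov_chain_def)
    then show ?thesis using True unfolding cond_prob_def split by (simp add: field_simps)
  next
    case False
    then have 0: "prob {\<omega> \<in> space M. \<forall>l\<le>k. X l \<omega> = h l} = 0"
      using measure_nonneg[of M] by (simp add: not_less antisym)
    have "prob {\<omega> \<in> space M. \<forall>l\<le>Suc k. X l \<omega> = h l} \<le> prob {\<omega> \<in> space M. \<forall>l\<le>k. X l \<omega> = h l}"
      by (rule finite_measure_mono[OF _ set]) auto
    with 0 show ?thesis using measure_nonneg[of M] by (simp add: antisym)
  qed
qed

lemma (in prob_space) independent_histories:
  assumes ind: "independent_processes M N X L Y"
    and X: "\<And>l. X l \<in> measurable M (count_space {1..N})"
    and Y: "\<And>l. Y l \<in> measurable M (count_space {1..L})"
  shows "prob {\<omega> \<in> space M. \<forall>l\<le>k. X l \<omega> = a l \<and> Y l \<omega> = b l} =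
    prob {\<omega> \<in> space M. \<forall>l\<le>k. X l \<omega> = a l} * prob {\<omega> \<in> space M. \<forall>l\<le>k. Y l \<omega> = b l}"
proof -
  define cyl where "cyl J d = {f \<in> space (Pi\<^sub>M UNIV (\<lambda>_. count_space {1..J})). \<forall>l\<le>k. f l = d l}"
    for J and d :: "nat \<Rightarrow> nat"
  have cyl: "cyl J d \<in> sets (Pi\<^sub>M UNIV (\<lambda>_. count_space {1..J}))" for J d
  proof -
    have "cyl J d = (\<Inter>l\<in>{..k}. (\<lambda>f. f l) -` ({d l} \<inter> {1..J}) \<inter> space (Pi\<^sub>M UNIV (\<lambda>_. count_space {1..J})))"
      by (auto simp: cyl_def space_PiM)
    also have "\<dots> \<in> sets (Pi\<^sub>M UNIV (\<lambda>_. count_space {1..J}))"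
      by (intro sets.finite_INT measurable_sets[OF measurable_component_singleton]) auto
    finally show ?thesis .
  qed
  have iff: "(\<lambda>k. X k \<omega>) \<in> cyl N a \<longleftrightarrow> (\<forall>l\<le>k. X l \<omega> = a l)"
    "(\<lambda>k. Y k \<omega>) \<in> cyl L b \<longleftrightarrow> (\<forall>l\<le>k. Y l \<omega> = b l)" if "\<omega> \<in> space M" for \<omega>
    using measurable_space[OF X that] measurable_space[OF Y that] by (auto simp: cyl_def space_PiM)
  have vimages: "(\<lambda>\<omega> k. X k \<omega>) -` cyl N a \<inter> space M = {\<omega> \<in> space M. \<forall>l\<le>k. X l \<omega> = a l}"
    "(\<lambda>\<omega> k. Y k \<omega>) -` cyl L b \<inter> space M = {\<omega> \<in> space M. \<forall>l\<le>k. Y l \<omega> = b l}"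
    "(\<lambda>\<omega>. (\<lambda>k. X k \<omega>, \<lambda>k. Y k \<omega>)) -` (cyl N a \<times> cyl L b) \<inter> space M =
      {\<omega> \<in> space M. \<forall>l\<le>k. X l \<omega> = a l \<and> Y l \<omega> = b l}"
    using iff by auto
  show ?thesis
    using indep_varD[OF ind[unfolded independent_processes_def] cyl cyl, of a b]
    unfolding vimages by simp
qed

lemma measurable_count_space_UNIV:
  "f \<in> measurable M (count_space A) \<Longrightarrow> f \<in> measurable M (count_space UNIV)"
  by (erule measurable_compose) simp

lemma measurable_discrete3:
  fixes f :: "'w \<Rightarrow> 'a::countable" and g :: "'w \<Rightarrow> 'b::countable"
  assumes f: "f \<in> measurable M (count_space UNIV)" and g: "g \<in> measurable M (count_space UNIV)"
    and e: "e \<in> measurable M (count_space UNIV)"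
  shows "(\<lambda>\<omega>. F (f \<omega>) (g \<omega>) (e \<omega>)) \<in> measurable M (count_space UNIV)"
proof -
  have "(\<lambda>\<omega>. F a b (e \<omega>)) \<in> measurable M (count_space UNIV)" for a b
    by (rule measurable_compose[OF e]) simp
  then have "(\<lambda>\<omega>. F a (g \<omega>) (e \<omega>)) \<in> measurable M (count_space UNIV)" for a
    by (rule measurable_compose_countable[where f = "\<lambda>b \<omega>. F a b (e \<omega>)", OF _ g])
  then show ?thesis
    by (rule measurable_compose_countable[where f = "\<lambda>a \<omega>. F a (g \<omega>) (e \<omega>)", OF _ f])
qed

lemma ext_path_measurable:
  fixes X Y :: "nat \<Rightarrow> 'w \<Rightarrow> nat"
  assumes X: "\<And>l. X l \<in> measurable M (count_space UNIV)"
    and Y: "\<And>l. Y l \<in> measurable M (count_space UNIV)"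
  shows "(\<lambda>\<omega>. ext_path \<Lambda> T z (\<lambda>l. X l \<omega>) (\<lambda>l. Y l \<omega>) k) \<in> measurable M (count_space UNIV)"
proof (induction k)
  case 0
  show ?case unfolding ext_path.simps
    by (rule measurable_discrete3[where F = "ext_next \<Lambda> T", OF X Y]) simp
next
  case (Suc k)
  show ?case unfolding ext_path.simps
    by (rule measurable_discrete3[where F = "ext_next \<Lambda> T", OF X Y Suc])
qed

text \<open>
  For a history \<open>h\<close> that obeys the recursion, independence turns the probability of \<open>h\<close> into a product
  of two history probabilities, each of which gains one transition factor per step.  If \<open>h\<close>
  violates the recursion at the last step, the indicator in \<^const>\<open>ext_trans\<close> vanishes; if it does so
  earlier, both sides are zero.
\<close>

lemma (in prob_space) ext_path_chain:
  assumes T: "T > 0" and p: "transition_matrix N p" and q: "transition_matrix L q"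
    and X: "markov_chain M N p r0 X" and Y: "markov_chain M L q s0 Y"
    and ind: "independent_processes M N X L Y"
    and z: "fst (snd (snd z)) \<in> {1..N}"
  shows "finite_state_chain M (ext_modes N L T) (ext_trans p q \<Lambda> T)
    (\<lambda>k \<omega>. ext_path \<Lambda> T z (\<lambda>l. X l \<omega>) (\<lambda>l. Y l \<omega>) k)"
proof unfold_locales
  let ?c = "\<lambda>k \<omega>. ext_path \<Lambda> T z (\<lambda>l. X l \<omega>) (\<lambda>l. Y l \<omega>) k"
  have Xm: "X l \<in> measurable M (count_space {1..N})"
    and Ym: "Y l \<in> measurable M (count_space {1..L})" for l
    using X Y by (simp_all add: markov_chain_def)
  show "finite (ext_modes N L T)" by (simp add: ext_modes_def)
  show "0 \<le> ext_trans p q \<Lambda> T i j" if "i \<in> ext_modes N L T" "j \<in> ext_modes N L T" for i j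
    using that p q by (auto simp: ext_trans_eq ext_modes_def transition_matrix_def)
  show "?c k \<in> measurable M (count_space (ext_modes N L T))" for k
  proof (subst measurable_count_space_eq2)
    show "finite (ext_modes N L T)" by (simp add: ext_modes_def)
    have "?c k \<in> measurable M (count_space UNIV)"
      by (intro ext_path_measurable measurable_count_space_UNIV[OF Xm] measurable_count_space_UNIV[OF Ym])
    moreover have "?c k \<in> space M \<rightarrow> ext_modes N L T"
      using measurable_space[OF Xm] measurable_space[OF Ym] T z by (auto intro!: ext_path_in_ext_modes)
    ultimately show "?c k \<in> space M \<rightarrow> ext_modes N L T \<and>
        (\<forall>a\<in>ext_modes N L T. ?c k -` {a} \<inter> space M \<in> events)"
      by (auto intro: measurable_sets)
  qed
  fix k and h :: "nat \<Rightarrow> ext_mode"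
  assume h: "\<And>l. l \<le> Suc k \<Longrightarrow> h l \<in> ext_modes N L T"
  let ?a = "\<lambda>l. fst (h l)" and ?b = "\<lambda>l. fst (snd (h l))"
  let ?ok = "\<lambda>k. \<forall>l\<le>k. ext_path \<Lambda> T z ?a ?b l = h l"
  have a: "?a (Suc k) \<in> {1..N}" and b: "?b (Suc k) \<in> {1..L}"
    using h[of "Suc k"] by (auto simp: ext_modes_def)
  have iff: "(\<forall>l\<le>k. ?c l \<omega> = h l) \<longleftrightarrow> (\<forall>l\<le>k. X l \<omega> = ?a l \<and> Y l \<omega> = ?b l) \<and> ?ok k" for k \<omega>
    by (rule ext_path_history_iff)
  have law: "prob {\<omega> \<in> space M. \<forall>l\<le>k. ?c l \<omega> = h l} = of_bool (?ok k) *
      (prob {\<omega> \<in> space M. \<forall>l\<le>k. X l \<omega> = ?a l} * prob {\<omega> \<in> space M. \<forall>l\<le>k. Y l \<omega> = ?b l})" for k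
  proof (cases "?ok k")
    case True
    then have "{\<omega> \<in> space M. \<forall>l\<le>k. ?c l \<omega> = h l} =
        {\<omega> \<in> space M. \<forall>l\<le>k. X l \<omega> = ?a l \<and> Y l \<omega> = ?b l}"
      unfolding iff by simp
    then show ?thesis using True independent_histories[OF ind Xm Ym] by simp
  next
    case False
    then have empty: "{\<omega> \<in> space M. \<forall>l\<le>k. ?c l \<omega> = h l} = {}"
      unfolding iff by simp
    show ?thesis unfolding empty using False by simp
  qed
  have split: "(\<forall>l\<le>Suc k. Q l) \<longleftrightarrow> (\<forall>l\<le>k. Q l) \<and> Q (Suc k)" for Q
    by (auto simp: le_Suc_eq)
  have "?ok (Suc k) \<longleftrightarrow> ?ok k \<and> h (Suc k) = ext_next \<Lambda> T (?a (Suc k)) (?b (Suc k)) (h k)"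
    unfolding split ext_path.simps by (intro conj_cong refl) (metis order_refl)
  then show "prob {\<omega> \<in> space M. \<forall>l\<le>Suc k. ?c l \<omega> = h l} =
      prob {\<omega> \<in> space M. \<forall>l\<le>k. ?c l \<omega> = h l} * ext_trans p q \<Lambda> T (h k) (h (Suc k))"
    unfolding law markov_chain_path[where h = ?a, OF X a] markov_chain_path[where h = ?b, OF Y b]
      ext_trans_eq by (simp only: of_bool_conj mult_ac)
qed

section \<open>Measurability of the closed loop\<close>

lemma pred_remove_Least:
  fixes D :: "'w \<Rightarrow> nat set"
  assumes D: "\<And>j. Measurable.pred M (\<lambda>\<omega>. j \<in> D \<omega>)"
  shows "Measurable.pred M (\<lambda>\<omega>. j \<in> D \<omega> - {LEAST n. n \<in> D \<omega>})"
proof -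
  have "Measurable.pred M (\<lambda>\<omega>. j = (LEAST n. n \<in> D \<omega>))"
    by (rule pred_count_space_const2, rule measurable_Least, rule D)
  then show ?thesis
    unfolding Diff_iff singleton_iff
    by (rule pred_intros_logic(3)[OF D pred_intros_logic(2)])
qed

text \<open>
  This covers the paths \<open>\<omega>\<close> for which \<open>D \<omega>\<close> is finite as well: each step of the recursion of
  \<^const>\<open>enumerate\<close> takes \<^const>\<open>Least\<close> and removes the result, and both operations are measurable.
\<close>

lemma enumerate_measurable:
  fixes D :: "'w \<Rightarrow> nat set"
  assumes "\<And>j. Measurable.pred M (\<lambda>\<omega>. j \<in> D \<omega>)"
  shows "(\<lambda>\<omega>. enumerate (D \<omega>) i) \<in> measurable M (count_space UNIV)"
  using assms
proof (induction i arbitrary: D)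
  case 0
  show ?case unfolding enumerate_0 by (rule measurable_Least[OF 0])
next
  case (Suc i)
  show ?case
    unfolding enumerate_Suc by (rule Suc.IH, rule pred_remove_Least, rule Suc.prems)
qed

lemma last_observation_measurable:
  fixes t :: "'w \<Rightarrow> nat \<Rightarrow> nat"
  assumes [measurable]: "\<And>i. (\<lambda>\<omega>. t \<omega> i) \<in> measurable M (count_space UNIV)"
    and X: "\<And>l. X l \<in> measurable M (count_space UNIV)"
  shows "(\<lambda>\<omega>. last_obs_time (t \<omega>) \<tau>0 k) \<in> measurable M (count_space UNIV)"
    and "(\<lambda>\<omega>. last_obs_mode (t \<omega>) (\<lambda>l. X l \<omega>) \<sigma>0 k) \<in> measurable M (count_space UNIV)"
proof -
  have Max [measurable]: "(\<lambda>\<omega>. Max {t \<omega> i | i. t \<omega> i \<le> k}) \<in> measurable M (count_space UNIV)"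
    by measurable
  show "(\<lambda>\<omega>. last_obs_time (t \<omega>) \<tau>0 k) \<in> measurable M (count_space UNIV)"
    unfolding last_obs_time_def by measurable
  have [measurable]: "(\<lambda>\<omega>. X (Max {t \<omega> i | i. t \<omega> i \<le> k}) \<omega>) \<in> measurable M (count_space UNIV)"
    by (rule measurable_compose_countable[OF X Max])
  show "(\<lambda>\<omega>. last_obs_mode (t \<omega>) (\<lambda>l. X l \<omega>) \<sigma>0 k) \<in> measurable M (count_space UNIV)"
    unfolding last_obs_mode_def by measurable
qed

lemma closed_loop_measurable:
  fixes A :: "nat \<Rightarrow> real^'n^'n" and B :: "nat \<Rightarrow> real^'m^'n"
  assumes t: "\<And>i. (\<lambda>\<omega>. t \<omega> i) \<in> measurable M (count_space UNIV)"
    and X: "\<And>l. X l \<in> measurable M (count_space UNIV)"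
  shows "(\<lambda>\<omega>. closed_loop A B T K (\<lambda>l. X l \<omega>) (t \<omega>) \<tau>0 \<sigma>0 x0 k) \<in> borel_measurable M"
proof (induction k)
  case (Suc k)
  show ?case unfolding closed_loop.simps
    by (rule measurable_compose_countable[OF _ X[of k]],
        rule measurable_compose_countable[OF _ last_observation_measurable(2)[OF t X]],
        rule measurable_compose_countable[OF _ last_observation_measurable(1)[OF t X]],
        rule borel_measurable_continuous_on[OF matrix_vector_mult_linear_continuous_on Suc])
qed simp

section \<open>Stabilization\<close>

lemma finite_uniform_bounds:
  fixes a b :: real
  assumes "finite S" and "\<And>i. i \<in> S \<Longrightarrow> \<exists>e\<in>{a<..<b}. Q i e" and "a < b"
    and mono: "\<And>i e e'. i \<in> S \<Longrightarrow> Q i e \<Longrightarrow> e \<le> e' \<Longrightarrow> Q i e'"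
  shows "\<exists>e\<in>{a<..<b}. \<forall>i\<in>S. Q i e"
  using assms(1,2,4)
proof (induction S rule: finite_induct)
  case empty
  then show ?case using dense[OF assms(3)] by auto
next
  case (insert i S)
  obtain e1 where 1: "e1 \<in> {a<..<b}" "\<forall>i\<in>S. Q i e1"
    using insert.IH insert.prems by (metis insertCI)
  obtain e2 where 2: "e2 \<in> {a<..<b}" "Q i e2"
    using insert.prems(1)[of i] by blast
  have "Q j (max e1 e2)" if "j \<in> insert i S" for j
    using that 1(2) 2(2) insert.prems(2)[OF that] by (metis insertE max.cobounded1 max.cobounded2)
  moreover have "max e1 e2 \<in> {a<..<b}" using 1 2 by auto
  ultimately show ?case by blast
qed

theorem theoremV3:
  fixes \<Omega> :: "'w measure"
    and N M T :: nat
    and A :: "nat \<Rightarrow> real^'n^'n"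
    and B :: "nat \<Rightarrow> real^'m^'n"
    and p q :: "nat \<Rightarrow> nat \<Rightarrow> real"
    and r s :: "nat \<Rightarrow> nat \<Rightarrow> 'w \<Rightarrow> nat"
    and \<Lambda> :: "nat set"
    and R :: "nat \<times> nat \<times> nat \<times> nat \<Rightarrow> real^'n^'n"
    and G :: "nat \<Rightarrow> nat \<Rightarrow> real^'n^'n"
    and F K :: "nat \<Rightarrow> nat \<Rightarrow> real^'n^'m"
  assumes "prob_space \<Omega>"
    and "N > 0" and "M > 0" and "T > 0"
    and "transition_matrix N p" and "transition_matrix M q"
    and "\<And>r0. r0 \<in> {1..N} \<Longrightarrow> markov_chain \<Omega> N p r0 (r r0)"
    and "\<And>s0. s0 \<in> {1..M} \<Longrightarrow> markov_chain \<Omega> M q s0 (s s0)"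
    and "\<And>r0 s0. r0 \<in> {1..N} \<Longrightarrow> s0 \<in> {1..M} \<Longrightarrow>
           independent_processes \<Omega> N (r r0) M (s s0)"
    and "\<Lambda> \<subseteq> {1..M}" and "\<Lambda> \<noteq> {}"
    and "\<And>s0. s0 \<in> {1..M} \<Longrightarrow> AE \<omega> in \<Omega>. infinite {k. s s0 k \<omega> \<in> \<Lambda>}"
    and "\<And>\<alpha> \<beta> \<gamma> \<delta>. (\<alpha>, \<beta>, \<gamma>, \<delta>) \<in> ext_modes N M T \<Longrightarrow>
           positive_definite
             (block_matrix
               (R (\<alpha>, \<beta>, \<gamma>, \<delta>))
               (A \<alpha> ** G \<gamma> \<delta> + B \<alpha> ** F \<gamma> \<delta>)
               (transpose (G \<gamma> \<delta>) ** transpose (A \<alpha>) + transpose (F \<gamma> \<delta>) ** transpose (B \<alpha>))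
               (G \<gamma> \<delta> + transpose (G \<gamma> \<delta>) - ext_D N M T p q \<Lambda> R (\<alpha>, \<beta>, \<gamma>, \<delta>)))"
    and "\<And>\<gamma> \<delta>. \<gamma> \<in> {1..N} \<Longrightarrow> \<delta> \<in> {1..T} \<Longrightarrow> K \<gamma> \<delta> = F \<gamma> \<delta> ** matrix_inv (G \<gamma> \<delta>)"
  shows "stabilizes \<Omega> N A B r (observation_family M s \<Lambda>) T K"
proof -
  define S where "S = ext_modes N M T"
  define Pr where "Pr = ext_trans p q \<Lambda> T"
  define H where "H = (\<lambda>(\<alpha>, \<beta>::nat, \<gamma>, \<delta>). A \<alpha> + B \<alpha> ** K \<gamma> \<delta>)"
  define D where "D i = (\<Sum>i'\<in>S. Pr i' i *\<^sub>R R i')" for i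
  interpret prob_space \<Omega> by fact
  have finS: "finite S" by (simp add: S_def ext_modes_def)
  have Pr: "0 \<le> Pr i j" if "i \<in> S" "j \<in> S" for i j
    using that assms(5,6) by (auto simp: S_def Pr_def ext_trans_eq ext_modes_def transition_matrix_def)
  have Rpos: "0 < u \<bullet> (R i *v u)" if "i \<in> S" "u \<noteq> 0" for i u
  proof -
    obtain \<alpha> \<beta> \<gamma> \<delta> where i: "i = (\<alpha>, \<beta>, \<gamma>, \<delta>)" by (cases i)
    show ?thesis
      using positive_definite_block[OF assms(13)[of \<alpha> \<beta> \<gamma> \<delta>], of u 0] that
      by (simp add: i S_def)
  qed
  have Rnonneg: "0 \<le> u \<bullet> (R i *v u)" if "i \<in> S" for i u
    using Rpos[OF that, of u] by (cases "u = 0") simp_all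
  have D_form: "v \<bullet> (D i *v v) = (\<Sum>i'\<in>S. Pr i' i * (v \<bullet> (R i' *v v)))" for i v
    unfolding D_def using finS
    by (induction S rule: finite_induct)
       (simp_all add: matrix_vector_mult_add_rdistrib inner_add_right scaleR_matrix_vector_assoc[symmetric])
  have D_nonneg: "0 \<le> v \<bullet> (D i *v v)" if "i \<in> S" for i v
    unfolding D_form using that by (intro sum_nonneg mult_nonneg_nonneg Pr Rnonneg)
  have lyap: "(transpose (H i) *v u) \<bullet> (D i *v (transpose (H i) *v u)) < u \<bullet> (R i *v u)"
    if "i \<in> S" "u \<noteq> 0" for i u
  proof -
    obtain \<alpha> \<beta> \<gamma> \<delta> where i: "i = (\<alpha>, \<beta>, \<gamma>, \<delta>)" by (cases i)
    have "(\<alpha>, \<beta>, \<gamma>, \<delta>) \<in> ext_modes N M T" "\<gamma> \<in> {1..N}" "\<delta> \<in> {1..T}"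
      using that by (auto simp: i S_def ext_modes_def)
    moreover have "ext_D N M T p q \<Lambda> R i = D i" by (simp add: D_def ext_D_def S_def Pr_def)
    ultimately show ?thesis
      using assms(13)[of \<alpha> \<beta> \<gamma> \<delta>] D_nonneg[OF that(1)] that(2) assms(14)[of \<gamma> \<delta>]
      by (intro lmi_imp_lyapunov[of _ "A \<alpha>" "G \<gamma> \<delta>" "B \<alpha>" "F \<gamma> \<delta>"]) (simp_all add: i H_def)
  qed
  have "\<exists>e\<in>{0<..<1}. \<forall>i\<in>S. \<forall>u.
      (transpose (H i) *v u) \<bullet> (D i *v (transpose (H i) *v u)) \<le> e * (u \<bullet> (R i *v u))"
  proof (rule finite_uniform_bounds[OF finS])
    fix i assume i: "i \<in> S"
    have eq: "u \<bullet> ((H i ** D i ** transpose (H i)) *v u) =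
        (transpose (H i) *v u) \<bullet> (D i *v (transpose (H i) *v u))" for u
      by (metis dot_lmul_matrix matrix_vector_mul_assoc transpose_matrix_vector)
    show "\<exists>e\<in>{0<..<1}. \<forall>u.
        (transpose (H i) *v u) \<bullet> (D i *v (transpose (H i) *v u)) \<le> e * (u \<bullet> (R i *v u))"
      using strict_form_contraction[of "R i" "H i ** D i ** transpose (H i)"] Rpos[OF i] lyap[OF i]
      unfolding eq by blast
    fix e e' :: real
    assume "\<forall>u. (transpose (H i) *v u) \<bullet> (D i *v (transpose (H i) *v u)) \<le> e * (u \<bullet> (R i *v u))"
      and "e \<le> e'"
    then show "\<forall>u. (transpose (H i) *v u) \<bullet> (D i *v (transpose (H i) *v u)) \<le> e' * (u \<bullet> (R i *v u))"
      using mult_right_mono[OF _ Rnonneg[OF i]] order_trans by blast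
  qed simp
  then obtain e where e: "0 < e" "e < 1"
    and contr: "\<And>i u. i \<in> S \<Longrightarrow>
      (transpose (H i) *v u) \<bullet> (D i *v (transpose (H i) *v u)) \<le> e * (u \<bullet> (R i *v u))"
    by auto
  have "\<forall>i\<in>S. \<exists>b>0. \<forall>u x. ((transpose (H i) *v u) \<bullet> x)\<^sup>2 \<le> b * (norm x)\<^sup>2 * (u \<bullet> (R i *v u))"
    using dominated_by_positive_form[OF Rpos] by blast
  from bchoice[OF this] obtain b where b: "\<And>i. i \<in> S \<Longrightarrow> b i > 0"
    "\<And>i u x. i \<in> S \<Longrightarrow> ((transpose (H i) *v u) \<bullet> x)\<^sup>2 \<le> b i * (norm x)\<^sup>2 * (u \<bullet> (R i *v u))"
    by blast
  define \<kappa> where "\<kappa> = (\<Sum>i\<in>S. b i)"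
  have \<kappa>: "\<kappa> \<ge> 0" unfolding \<kappa>_def by (intro sum_nonneg less_imp_le b)
  have init: "((transpose (H i) *v u) \<bullet> x)\<^sup>2 \<le> \<kappa> * (norm x)\<^sup>2 * (u \<bullet> (R i *v u))"
    if "i \<in> S" for i u x
  proof -
    have "b i \<le> \<kappa>" unfolding \<kappa>_def using that b(1) finS by (intro member_le_sum) (auto intro: less_imp_le)
    then show ?thesis
      using b(2)[OF that, of u x] Rnonneg[OF that, of u]
      by (meson mult_right_mono order_trans zero_le_power2)
  qed
  define C where "C = 1 + \<kappa> / e * (\<Sum>i\<in>S. \<Sum>b\<in>Basis. b \<bullet> (R i *v b))"
  have "C > 0"
    unfolding C_def using \<kappa> e by (intro add_pos_nonneg mult_nonneg_nonneg sum_nonneg Rnonneg) auto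
  have bound: "integrable \<Omega> x \<and> (\<integral>\<omega>. x \<omega> \<partial>\<Omega>) \<le> C * e ^ k * (norm x0)\<^sup>2"
    if r0: "r0 \<in> {1..N}" and \<sigma>0: "\<sigma>0 \<in> {1..N}" and s0: "s0 \<in> {1..M}"
      and x: "x = (\<lambda>\<omega>. (norm (closed_loop A B T K (\<lambda>l. r r0 l \<omega>) (hitting_times \<Lambda> (s s0) \<omega>) \<tau>0 \<sigma>0 x0 k))\<^sup>2)"
    for r0 \<sigma>0 s0 \<tau>0 x0 k x
  proof -
    define z where "z = (1::nat, 1::nat, \<sigma>0, wrap T (- \<tau>0))"
    interpret chain: finite_state_chain \<Omega> S Pr
      "\<lambda>k \<omega>. ext_path \<Lambda> T z (\<lambda>l. r r0 l \<omega>) (\<lambda>l. s s0 l \<omega>) k"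
      unfolding S_def Pr_def
      using \<sigma>0 by (intro ext_path_chain[OF assms(4-6) assms(7)[OF r0] assms(8)[OF s0] assms(9)[OF r0 s0]])
        (simp add: z_def)
    define y where "y \<omega> = (norm (jump_trajectory H x0
      (\<lambda>l. ext_path \<Lambda> T z (\<lambda>l. r r0 l \<omega>) (\<lambda>l. s s0 l \<omega>) l) k))\<^sup>2" for \<omega>
    have y: "integrable \<Omega> y" "(\<integral>\<omega>. y \<omega> \<partial>\<Omega>) \<le> C * e ^ k * (norm x0)\<^sup>2"
      unfolding y_def C_def
      using chain.mean_square_decay[OF \<kappa> e(1) Rnonneg init contr[unfolded D_def]] by auto
    have rm: "r r0 l \<in> measurable \<Omega> (count_space UNIV)"
      and sm: "s s0 l \<in> measurable \<Omega> (count_space UNIV)" for l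
      using assms(7)[OF r0] assms(8)[OF s0] measurable_count_space_UNIV
      unfolding markov_chain_def by blast+
    note [measurable] = sm
    have "(\<lambda>\<omega>. hitting_times \<Lambda> (s s0) \<omega> i) \<in> measurable \<Omega> (count_space UNIV)" for i
      unfolding hitting_times_def by (intro enumerate_measurable) simp
    from closed_loop_measurable[OF this rm]
    have [measurable]: "(\<lambda>\<omega>. closed_loop A B T K (\<lambda>l. r r0 l \<omega>) (hitting_times \<Lambda> (s s0) \<omega>) \<tau>0 \<sigma>0 x0 k)
        \<in> borel_measurable \<Omega>" .
    have xm: "x \<in> borel_measurable \<Omega>" unfolding x by measurable
    \<comment> \<open>Recurrence of \<open>\<Lambda>\<close> enters here.\<close>
    have ae: "AE \<omega> in \<Omega>. y \<omega> = x \<omega>"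
      using assms(12)[OF s0]
    proof eventually_elim
      case (elim \<omega>)
      then show ?case
        unfolding x y_def hitting_times_def H_def z_def
        by (subst closed_loop_eq_jump_trajectory[OF assms(4)]) auto
    qed
    have ym: "y \<in> borel_measurable \<Omega>" using y(1) by simp
    show ?thesis
      using y integrable_cong_AE[OF ym xm ae] integral_cong_AE[OF ym xm ae] by simp
  qed
  show ?thesis
    unfolding stabilizes_def observation_family_def Let_def
  proof (intro exI[of _ C] conjI bexI[of _ e] allI ballI impI \<open>C > 0\<close>)
    fix k x0 r0 \<tau>0 \<sigma>0 t
    assume "r0 \<in> {1..N}" "\<sigma>0 \<in> {1..N}" "t \<in> {hitting_times \<Lambda> (s s0) |s0. s0 \<in> {1..M}}"
    then obtain s0 where s0: "s0 \<in> {1..M}" "t = hitting_times \<Lambda> (s s0)" by blast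
    note * = bound[OF \<open>r0 \<in> {1..N}\<close> \<open>\<sigma>0 \<in> {1..N}\<close> s0(1) refl, of \<tau>0 x0 k]
    show "integrable \<Omega> (\<lambda>\<omega>. (norm (closed_loop A B T K (\<lambda>l. r r0 l \<omega>) (t \<omega>) \<tau>0 \<sigma>0 x0 k))\<^sup>2)"
      using * unfolding s0(2) by blast
    show "(\<integral>\<omega>. (norm (closed_loop A B T K (\<lambda>l. r r0 l \<omega>) (t \<omega>) \<tau>0 \<sigma>0 x0 k))\<^sup>2 \<partial>\<Omega>) \<le> C * e ^ k * (norm x0)\<^sup>2"
      using * unfolding s0(2) by blast
  qed (use e in auto)
qed

end
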